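(* Let $k \in \mathbb{N}=\{1,2,\dots\}$ and let $Y$ be a Young diagram. Then $Y$ can be covered by a set $C$ of generalized rectangles such that each row and each column of $Y$ is used by at most $k$ rectangles in $C$ if and only if $Y$ has strictly fewer than $\binom{2k}{k}$ steps.
   Context: For $x\in\mathbb{N}$ let $[x]=\{1,\dots,x\}$. A Young diagram with $r$ rows and $c$ columns is a set $Y\subseteq [r]\times[c]$ such that whenever $(i,j)\in Y$, then $(i-1,j)\in Y$ if $i\ge 2$ and $(i,j-1)\in Y$ if $j\ge 2$; elements of $Y$ are called cells, row $s$ consists of the cells $(s,\cdot)$ and column $t$ of the cells $(\cdot,t)$. A generalized rectangle in $Y$ is a set $R=S\times T$ with $S\subseteq[r]$, $T\subseteq[c]$ and $R\subseteq Y$; it uses the rows in $S$ and the columns in $T$. A set $C$ of generalized rectangles covers $Y$ if $Y=\bigcup_{R\in C}R$. The steps of $Y$ are the cells of $Z=\{(s,t)\in Y : (s+1,t)\notin Y \text{ and } (s,t+1)\notin Y\}$; the number of steps equals the number of distinct row lengths of $Y$. *)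

theory Defs
  imports Main
begin

definition young_diagram :: "nat \<Rightarrow> nat \<Rightarrow> (nat \<times> nat) set \<Rightarrow> bool" where
  "young_diagram r c Y \<longleftrightarrow>
     1 \<le> r \<and> 1 \<le> c \<and>
     Y \<subseteq> {1..r} \<times> {1..c} \<and>
     (\<forall>i j. (i, j) \<in> Y \<longrightarrow>
        (2 \<le> i \<longrightarrow> (i - 1, j) \<in> Y) \<and>
        (2 \<le> j \<longrightarrow> (i, j - 1) \<in> Y))"

definition gen_rectangle ::
    "nat \<Rightarrow> nat \<Rightarrow> (nat \<times> nat) set \<Rightarrow> (nat \<times> nat) set \<Rightarrow> bool" where
  "gen_rectangle r c Y R \<longleftrightarrow>
     (\<exists>S T. S \<subseteq> {1..r} \<and> T \<subseteq> {1..c} \<and> R = S \<times> T \<and> R \<subseteq> Y)"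

(* A nonempty rectangle R = S \<times> T determines its factors, S = fst ` R and T = snd ` R.
   The empty rectangle uses no row and no column. *)

definition rows_used :: "(nat \<times> nat) set \<Rightarrow> nat set" where
  "rows_used R = fst ` R"

definition cols_used :: "(nat \<times> nat) set \<Rightarrow> nat set" where
  "cols_used R = snd ` R"

definition covers :: "(nat \<times> nat) set set \<Rightarrow> (nat \<times> nat) set \<Rightarrow> bool" where
  "covers C Y \<longleftrightarrow> Y = (\<Union>R\<in>C. R)"

definition steps :: "(nat \<times> nat) set \<Rightarrow> (nat \<times> nat) set" where
  "steps Y = {(s, t). (s, t) \<in> Y \<and> (s + 1, t) \<notin> Y \<and> (s, t + 1) \<notin> Y}"

end

theory Submission
  imports Defs
begin

text \<open>
  Both directions rest on Pascal's rule, for the more general problem in which rows may be used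
  \<open>a\<close> times and columns \<open>b\<close> times, the threshold being \<open>(a + b) choose a\<close>.

  To construct a cover, choose a step such that fewer than \<open>(a + b - 1) choose (a - 1)\<close> steps lie
  above it and fewer than \<open>(a + b - 1) choose a\<close> below it. The full rectangle spanned by that step
  costs one use of each of its rows and columns, and it leaves a part to the right, which shares
  rows but no columns with it, and a part below, which shares columns but no rows.

  Conversely, let \<open>A i\<close> and \<open>B i\<close> be the sets of rectangles that use the row and the column of the
  \<open>i\<close>-th step. Then \<open>A i\<close> meets \<open>B j\<close> exactly if \<open>i \<le> j\<close>. Among the first
  \<open>(a + b - 1) choose (a - 1)\<close> indices some \<open>A i\<close> has all its \<open>a\<close> elements in sets \<open>B j\<close> with \<open>j\<close> among
  these same indices. Every later \<open>B j\<close> then wastes an element on meeting \<open>A i\<close>, so the later indices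
  are governed by \<open>(a, b - 1)\<close>.
\<close>

section \<open>A bound for skew set pairs\<close>

text \<open>Supplies the cut point in both directions: it splits the index set in
  \<open>skew_pairs_bound\<close> and picks the step in \<open>exists_cover\<close>.\<close>

lemma exists_element_of_rank:
  fixes I :: "'i::linorder set"
  assumes "finite I" "m < card I"
  shows "\<exists>z\<in>I. card {y \<in> I. y < z} = m"
  using assms(2)
proof (induction m)
  case 0
  then have "I \<noteq> {}" by auto
  then have "{y \<in> I. y < Min I} = {}" "Min I \<in> I"
    using assms(1) by (auto simp: not_less)
  then show ?case by (metis card.empty)
next
  case (Suc m)
  then obtain z where z: "z \<in> I" "card {y \<in> I. y < z} = m" by auto
  have below: "card (insert z {y \<in> I. y < z}) = Suc m"
    using z assms(1) by simp
  let ?L = "{y \<in> I. z < y}"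
  have "?L \<noteq> {}"
  proof
    assume "?L = {}"
    then have "I \<subseteq> insert z {y \<in> I. y < z}" by auto
    then have "card I \<le> card (insert z {y \<in> I. y < z})"
      using assms(1) by (intro card_mono) auto
    then have "card I \<le> Suc m" using below by simp
    then show False using Suc.prems by simp
  qed
  then have L: "Min ?L \<in> ?L" using assms(1) by (intro Min_in) auto
  have "{y \<in> I. y < Min ?L} = insert z {y \<in> I. y < z}"
  proof -
    have "\<not> y < Min ?L" if "y \<in> ?L" for y
      using that assms(1) by (simp add: not_less)
    then have "y \<in> I \<and> y < Min ?L \<longleftrightarrow> y = z \<or> y \<in> I \<and> y < z" for y
      using L z(1) by (cases y z rule: linorder_cases) auto
    then show ?thesis by auto
  qed
  then have "card {y \<in> I. y < Min ?L} = Suc m" using below by simp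
  then show ?case using L by blast
qed

text \<open>A Bollobas-type inequality. Separate bounds \<open>a\<close> and \<open>b\<close> let
  the induction on \<open>a + b\<close> lower one of them, and an arbitrary linearly ordered
  \<open>I\<close> allows passing to subsets without reindexing.\<close>

lemma skew_pairs_bound:
  fixes I :: "'i::linorder set" and A B :: "'i \<Rightarrow> 'x set"
  assumes "finite I"
    and "\<And>i. i \<in> I \<Longrightarrow> finite (A i) \<and> card (A i) \<le> a"
    and "\<And>i. i \<in> I \<Longrightarrow> finite (B i) \<and> card (B i) \<le> b"
    and "\<And>i j. \<lbrakk>i \<in> I; j \<in> I\<rbrakk> \<Longrightarrow> A i \<inter> B j \<noteq> {} \<longleftrightarrow> i \<le> j"
  shows "card I < (a + b) choose a"
  using assms
proof (induction "a + b" arbitrary: a b I A B)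
  case 0
  then have "I = {}" by fastforce
  then show ?case by simp
next
  case (Suc n)
  note fin = Suc.prems(1) and A = Suc.prems(2) and B = Suc.prems(3) and meet = Suc.prems(4)
  show ?case
  proof (cases "a = 0 \<or> b = 0")
    case True
    have "I = {}"
    proof (rule equals0I)
      fix i assume "i \<in> I"
      then show False using True A[of i] B[of i] meet[of i i] by auto
    qed
    then show ?thesis by simp
  next
    case False
    then obtain a' b' where ab: "a = Suc a'" "b = Suc b'" by (meson not0_implies_Suc)
    define m where "m = (a' + b) choose a'"
    have pascal: "(a + b) choose a = m + ((a + b') choose a)"
      unfolding m_def ab by simp
    have pos: "0 < (a + b') choose a" by (simp add: zero_less_binomial)
    show ?thesis
    proof (rule ccontr)
      assume "\<not> card I < (a + b) choose a"
      then have large: "m + ((a + b') choose a) \<le> card I" using pascal by simp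
      then obtain z where z: "z \<in> I" "card {y \<in> I. y < z} = m"
        using exists_element_of_rank[OF fin, of m] pos by auto
      let ?J = "{y \<in> I. y < z}" and ?K = "{y \<in> I. z \<le> y}"
      \<comment> \<open>Otherwise trimming each \<open>A i\<close> to the elements of the sets
        \<open>B j\<close> with \<open>j\<close> in \<open>?J\<close> removes something from every
        \<open>A i\<close> but keeps all intersections; induction for \<open>a'\<close> and
        \<open>b\<close> then gives \<open>card ?J < m\<close>, although \<open>?J\<close> has
        exactly \<open>m\<close> elements.\<close>
      have "\<exists>i\<in>?J. A i \<subseteq> (\<Union>j\<in>?J. B j)"
      proof (rule ccontr)
        assume none: "\<not> ?thesis"
        have "card ?J < (a' + b) choose a'"
        proof (rule Suc.hyps(1)[where A = "\<lambda>i. A i \<inter> (\<Union>j\<in>?J. B j)" and B = B])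
          fix i assume i: "i \<in> ?J"
          then have "A i \<inter> (\<Union>j\<in>?J. B j) \<subset> A i" using none by blast
          then have "card (A i \<inter> (\<Union>j\<in>?J. B j)) < card (A i)"
            using A i by (intro psubset_card_mono) auto
          then show "finite (A i \<inter> (\<Union>j\<in>?J. B j)) \<and> card (A i \<inter> (\<Union>j\<in>?J. B j)) \<le> a'"
            using A[of i] i ab by auto
        next
          fix i j assume ij: "i \<in> ?J" "j \<in> ?J"
          then have "A i \<inter> (\<Union>j\<in>?J. B j) \<inter> B j = A i \<inter> B j" by blast
          then show "A i \<inter> (\<Union>j\<in>?J. B j) \<inter> B j \<noteq> {} \<longleftrightarrow> i \<le> j"
            using meet ij by auto
        qed (use Suc.hyps(2) ab fin B in auto)
        then show False using z(2) m_def by simp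
      qed
      then obtain i where i: "i \<in> I" "i < z" "A i \<subseteq> (\<Union>j\<in>?J. B j)" by auto
      have "card ?K < (a + b') choose a"
      proof (rule Suc.hyps(1)[where A = A and B = "\<lambda>j. B j \<inter> (\<Union>i\<in>?K. A i)"])
        fix j assume j: "j \<in> ?K"
        then have "A i \<inter> B j \<noteq> {}" using meet[of i j] i by auto
        \<comment> \<open>This \<open>x\<close> is wasted: it lies in \<open>B j'\<close> with
          \<open>j' < z\<close>, hence in no \<open>A i'\<close> with \<open>z \<le> i'\<close>.
          Trimming \<open>B j\<close> to the later sets \<open>A i'\<close> therefore loses
          it.\<close>
        then obtain x j' where x: "x \<in> B j" "j' \<in> ?J" "x \<in> B j'" using i(3) by blast
        have "x \<notin> A i'" if "i' \<in> ?K" for i'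
          using that meet[of i' j'] x by auto
        then have "B j \<inter> (\<Union>i\<in>?K. A i) \<subset> B j" using x(1) by blast
        then have "card (B j \<inter> (\<Union>i\<in>?K. A i)) < card (B j)"
          using B j by (intro psubset_card_mono) auto
        then show "finite (B j \<inter> (\<Union>i\<in>?K. A i)) \<and> card (B j \<inter> (\<Union>i\<in>?K. A i)) \<le> b'"
          using B[of j] j ab by auto
      next
        fix i j assume ij: "i \<in> ?K" "j \<in> ?K"
        then have "A i \<inter> (B j \<inter> (\<Union>i\<in>?K. A i)) = A i \<inter> B j" by blast
        then show "A i \<inter> (B j \<inter> (\<Union>i\<in>?K. A i)) \<noteq> {} \<longleftrightarrow> i \<le> j"
          using meet ij by auto
      qed (use Suc.hyps(2) ab fin A in auto)
      moreover have "card I \<le> m + card ?K"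
      proof -
        have "I = ?J \<union> ?K" by auto
        then have "card I \<le> card ?J + card ?K" by (metis card_Un_le)
        then show ?thesis using z(2) by simp
      qed
      ultimately show False using large by simp
    qed
  qed
qed

section \<open>Translated Young diagrams and their steps\<close>

text \<open>Young diagrams translated to an arbitrary corner \<open>(p, q)\<close>: the class that is closed under
  cutting off the rows or columns up to a step.\<close>

definition young_at :: "nat \<Rightarrow> nat \<Rightarrow> (nat \<times> nat) set \<Rightarrow> bool" where
  "young_at p q D \<longleftrightarrow> finite D \<and> D \<subseteq> {p<..} \<times> {q<..} \<and>
     (\<forall>s t s' t'. (s, t) \<in> D \<longrightarrow> p < s' \<longrightarrow> s' \<le> s \<longrightarrow> q < t' \<longrightarrow> t' \<le> t \<longrightarrow> (s', t') \<in> D)"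

lemma young_at_mem:
  "\<lbrakk>young_at p q D; (s, t) \<in> D; p < s'; s' \<le> s; q < t'; t' \<le> t\<rbrakk> \<Longrightarrow> (s', t') \<in> D"
  unfolding young_at_def by metis

lemma young_at_bounds:
  "\<lbrakk>young_at p q D; (s, t) \<in> D\<rbrakk> \<Longrightarrow> p < s \<and> q < t"
  unfolding young_at_def by auto

lemma young_diagram_young_at:
  assumes "young_diagram r c Y"
  shows "young_at 0 0 Y"
proof -
  have sub: "Y \<subseteq> {1..r} \<times> {1..c}" using assms by (simp add: young_diagram_def)
  have up: "(i, Suc j) \<in> Y \<Longrightarrow> 1 \<le> j \<Longrightarrow> (i, j) \<in> Y"
    and left: "(Suc i, j) \<in> Y \<Longrightarrow> 1 \<le> i \<Longrightarrow> (i, j) \<in> Y" for i j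
    using assms unfolding young_diagram_def by fastforce+
  have rows: "(s', t) \<in> Y" if "s' \<le> s" "(s, t) \<in> Y" "0 < s'" for s s' t
    using that by (induction rule: dec_induct) (simp_all add: left)
  have cols: "(s, t') \<in> Y" if "t' \<le> t" "(s, t) \<in> Y" "0 < t'" for s t t'
    using that by (induction rule: dec_induct) (simp_all add: up)
  have "finite Y" using finite_subset[OF sub] by simp
  moreover have "Y \<subseteq> {0<..} \<times> {0<..}" using sub by auto
  ultimately show ?thesis unfolding young_at_def using rows cols by blast
qed

lemma finite_steps: "finite D \<Longrightarrow> finite (steps D)"
  by (rule finite_subset[of _ D]) (auto simp: steps_def)

text \<open>If \<open>t \<le> t'\<close>, the cell below the first step would be dominated by the
  second and so belong to \<open>D\<close>.\<close>

lemma steps_antimono: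
  assumes "young_at p q D" "(s, t) \<in> steps D" "(s', t') \<in> steps D" "s < s'"
  shows "t' < t"
proof (rule ccontr)
  assume "\<not> t' < t"
  then have "(s + 1, t) \<in> D"
    using assms young_at_bounds[of p q D s t]
    by - (rule young_at_mem[of p q D s' t'], auto simp: steps_def)
  then show False using assms(2) by (simp add: steps_def)
qed

text \<open>Allows steps to be counted and ordered by their row numbers.\<close>

lemma inj_on_fst_steps:
  assumes "young_at p q D"
  shows "inj_on fst (steps D)"
proof -
  have "\<not> t < t'" if "(s, t) \<in> steps D" "(s, t') \<in> steps D" for s t t'
  proof
    assume "t < t'"
    then have "(s, t + 1) \<in> D"
      using assms that young_at_bounds[of p q D s t]
      by - (rule young_at_mem[of p q D s t'], auto simp: steps_def)
    then show False using that by (simp add: steps_def)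
  qed
  then have "t = t'" if "(s, t) \<in> steps D" "(s, t') \<in> steps D" for s t t'
    using that by (meson linorder_neqE_nat)
  then show ?thesis by (auto intro: inj_onI)
qed

text \<open>A cell with maximal coordinate sum has no neighbour to the right or below.\<close>

lemma steps_nonempty:
  assumes "finite D" "D \<noteq> {}"
  shows "steps D \<noteq> {}"
proof -
  have "Max ((\<lambda>(s, t). s + t) ` D) \<in> (\<lambda>(s, t). s + t) ` D" using assms by (intro Max_in) auto
  then obtain s t where st: "(s, t) \<in> D" "s + t = Max ((\<lambda>(s, t). s + t) ` D)" by auto
  have "s' + t' \<le> s + t" if "(s', t') \<in> D" for s' t'
    unfolding st(2) using that assms(1) by (intro Max_ge) force+
  then have "(s, t) \<in> steps D" using st(1) by (fastforce simp: steps_def)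
  then show ?thesis by auto
qed

section \<open>Construction of a cover\<close>

text \<open>Here \<open>P R\<close> will say that \<open>R\<close> uses a fixed row or column; the
  new rectangle \<open>Q\<close> costs at most one use.\<close>

lemma card_filter_insert_Un_le:
  assumes "finite C1" "finite C2"
    and "card {R \<in> C1. P R} \<le> m" "\<And>R. R \<in> C2 \<Longrightarrow> \<not> P R"
  shows "card {R \<in> insert Q (C1 \<union> C2). P R} \<le> Suc m"
proof -
  have "card {R \<in> insert Q (C1 \<union> C2). P R} \<le> card (insert Q {R \<in> C1. P R})"
    using assms by (intro card_mono) auto
  also have "\<dots> \<le> Suc m" using assms card_insert_le_m1[of "Suc m"] by simp
  finally show ?thesis .
qed

text \<open>The condition \<open>fst ` R \<times> snd ` R = R\<close> says that \<open>R\<close> is a generalized rectangle.\<close>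

lemma exists_cover:
  assumes "young_at p q D" "card (steps D) < (a + b) choose a"
  shows "\<exists>C. finite C \<and> (\<forall>R\<in>C. fst ` R \<times> snd ` R = R) \<and> \<Union>C = D \<and>
           (\<forall>s. card {R \<in> C. s \<in> fst ` R} \<le> a) \<and> (\<forall>t. card {R \<in> C. t \<in> snd ` R} \<le> b)"
  using assms
proof (induction "a + b" arbitrary: a b p q D rule: less_induct)
  case less
  note D = less.prems(1)
  have finD: "finite D" using D by (simp add: young_at_def)
  show ?case
  proof (cases "D = {}")
    case True
    then show ?thesis by (intro exI[of _ "{}"]) auto
  next
    case False
    define I where "I = fst ` steps D"
    have finI: "finite I" using finite_steps[OF finD] by (simp add: I_def)
    have cardI: "card I = card (steps D)"
      unfolding I_def by (rule card_image[OF inj_on_fst_steps[OF D]])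
    have I0: "0 < card I"
      using cardI steps_nonempty[OF finD False] finite_steps[OF finD] by (simp add: card_gt_0_iff)
    have "a \<noteq> 0" "b \<noteq> 0" using less.prems(2) I0 cardI by (auto intro: ccontr)
    then obtain a' b' where ab: "a = Suc a'" "b = Suc b'" by (meson not0_implies_Suc)
    define m n where "m = (a' + b) choose a'" and "n = (a + b') choose a"
    have pascal: "(a + b) choose a = m + n"
      unfolding m_def n_def ab by simp
    have pos: "0 < m" "0 < n"
      unfolding m_def n_def by (simp_all add: zero_less_binomial)
    \<comment> \<open>The number of steps above the chosen one: \<open>m - 1\<close> if there are
      enough steps, otherwise the last step is taken. In the first case fewer than \<open>n\<close>
      steps remain below, in the second none.\<close>
    define e where "e = min (card I - 1) (m - 1)"
    have e: "e \<le> m - 1" "e = card I - 1 \<or> e = m - 1"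
      unfolding e_def by (auto simp: min_def)
    have "e < card I" using I0 by (simp add: e_def)
    then obtain z where z: "z \<in> I" "card {y \<in> I. y < z} = e"
      using exists_element_of_rank[OF finI] by blast
    then obtain w where w: "(z, w) \<in> steps D" by (auto simp: I_def)
    then have zwD: "(z, w) \<in> D" and nz: "(z + 1, w) \<notin> D" and nw: "(z, w + 1) \<notin> D"
      by (auto simp: steps_def)
    have pq: "p < z" "q < w" using young_at_bounds[OF D zwD] by auto
    let ?R = "{p<..z} \<times> {q<..w}"
    let ?D1 = "{(s, t) \<in> D. w < t}" and ?D2 = "{(s, t) \<in> D. z < s}"
    have right: "s < z" if "(s, t) \<in> D" "w < t" for s t
    proof (rule ccontr)
      assume "\<not> s < z"
      then have "(z, w + 1) \<in> D" using that pq by - (rule young_at_mem[OF D that(1)], auto)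
      then show False using nw by simp
    qed
    have below: "t < w" if "(s, t) \<in> D" "z < s" for s t
    proof (rule ccontr)
      assume "\<not> t < w"
      then have "(z + 1, w) \<in> D" using that pq by - (rule young_at_mem[OF D that(1)], auto)
      then show False using nz by simp
    qed
    have D1: "young_at p w ?D1" and D2: "young_at z q ?D2"
      using D pq finite_subset[of ?D1 D] finite_subset[of ?D2 D] finD
      unfolding young_at_def by (auto intro: less_trans le_less_trans)
    have c1: "card (steps ?D1) \<le> e"
    proof -
      \<comment> \<open>Cutting off the columns up to \<open>w\<close> creates no new steps, because
        the right and lower neighbours of a cell of \<open>?D1\<close> stay in columns beyond
        \<open>w\<close>. The same holds for rows and \<open>?D2\<close>.\<close>
      have "fst ` steps ?D1 \<subseteq> {y \<in> I. y < z}"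
        using right by (force simp: steps_def I_def)
      then have "card (fst ` steps ?D1) \<le> e" using z(2) finI card_mono[of "{y \<in> I. y < z}"] by auto
      then show ?thesis by (simp add: card_image[OF inj_on_fst_steps[OF D1]])
    qed
    have c2: "card (steps ?D2) \<le> card I - 1 - e"
    proof -
      have "fst ` steps ?D2 \<subseteq> I - insert z {y \<in> I. y < z}"
        by (force simp: steps_def I_def)
      then have "card (fst ` steps ?D2) \<le> card (I - insert z {y \<in> I. y < z})"
        using finI by (intro card_mono) auto
      also have "\<dots> = card I - card (insert z {y \<in> I. y < z})"
        using finI z(1) by (intro card_Diff_subset) auto
      also have "\<dots> = card I - 1 - e" using finI z by simp
      finally show ?thesis by (simp add: card_image[OF inj_on_fst_steps[OF D2]])
    qed
    have "card (steps ?D1) < (a' + b) choose a'"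
      using c1 e(1) pos(1) unfolding m_def[symmetric] by linarith
    from less.hyps[OF _ D1 this] ab
    obtain C1 where C1: "finite C1" "\<And>R. R \<in> C1 \<Longrightarrow> fst ` R \<times> snd ` R = R" "\<Union>C1 = ?D1"
      "\<And>s. card {R \<in> C1. s \<in> fst ` R} \<le> a'" "\<And>t. card {R \<in> C1. t \<in> snd ` R} \<le> b" by auto
    have "card (steps ?D2) < (a + b') choose a"
      using c2 e(2) pos less.prems(2) pascal cardI unfolding n_def[symmetric] by linarith
    from less.hyps[OF _ D2 this] ab
    obtain C2 where C2: "finite C2" "\<And>R. R \<in> C2 \<Longrightarrow> fst ` R \<times> snd ` R = R" "\<Union>C2 = ?D2"
      "\<And>s. card {R \<in> C2. s \<in> fst ` R} \<le> a" "\<And>t. card {R \<in> C2. t \<in> snd ` R} \<le> b'" by auto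
    have C1_sub: "s < z \<and> w < t" if "R \<in> C1" "(s, t) \<in> R" for R s t
      using that C1(3) right by blast
    have C2_sub: "z < s \<and> t < w" if "R \<in> C2" "(s, t) \<in> R" for R s t
      using that C2(3) below by blast
    let ?C = "insert ?R (C1 \<union> C2)"
    have "\<Union>?C = D"
    proof -
      have "?R \<subseteq> D" using young_at_mem[OF D zwD] by auto
      moreover have "D \<subseteq> ?R \<union> ?D1 \<union> ?D2" using young_at_bounds[OF D] by force
      ultimately show ?thesis using C1(3) C2(3) by auto
    qed
    moreover have "card {R \<in> ?C. s \<in> fst ` R} \<le> a" for s
    proof (cases "s \<le> z")
      case True
      then show ?thesis unfolding ab
        using C2_sub by (intro card_filter_insert_Un_le C1 C2) force
    next
      case False
      then have "{R \<in> ?C. s \<in> fst ` R} = {R \<in> C2. s \<in> fst ` R}" using C1_sub by force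
      then show ?thesis using C2(4) by simp
    qed
    moreover have "card {R \<in> ?C. t \<in> snd ` R} \<le> b" for t
    proof (cases "t \<le> w")
      case True
      \<comment> \<open>For columns the families trade places: those up to \<open>w\<close> meet
        only \<open>?R\<close> and \<open>C2\<close>, hence the swapped union.\<close>
      have "card {R \<in> insert ?R (C2 \<union> C1). t \<in> snd ` R} \<le> Suc b'"
        using C1_sub True by (intro card_filter_insert_Un_le C1 C2) force
      then show ?thesis by (simp add: ab Un_commute)
    next
      case False
      then have "{R \<in> ?C. t \<in> snd ` R} = {R \<in> C1. t \<in> snd ` R}" using C2_sub by force
      then show ?thesis using C1(5) by simp
    qed
    moreover have "fst ` R \<times> snd ` R = R" if "R \<in> ?C" for R
    proof -
      have "fst ` ?R \<times> snd ` ?R = ?R" by auto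
      then show ?thesis using that C1(2) C2(2) by blast
    qed
    moreover have "finite ?C" using C1(1) C2(1) by simp
    ultimately show ?thesis by (intro exI[of _ ?C] conjI allI ballI)
  qed
qed

section \<open>The bound on the steps of a covered diagram\<close>

text \<open>Uses are bounded only for rows and columns that \<open>D\<close> occupies, since the
  theorem controls nothing outside \<open>{1..r}\<close> and \<open>{1..c}\<close>.\<close>

lemma steps_bound_of_cover:
  assumes D: "young_at p q D" and rect: "\<And>R. R \<in> C \<Longrightarrow> fst ` R \<times> snd ` R = R" and cov: "\<Union>C = D"
    and rows: "\<And>s. s \<in> fst ` D \<Longrightarrow> card {R \<in> C. s \<in> fst ` R} \<le> a"
    and cols: "\<And>t. t \<in> snd ` D \<Longrightarrow> card {R \<in> C. t \<in> snd ` R} \<le> b"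
  shows "card (steps D) < (a + b) choose a"
proof -
  have finD: "finite D" using D by (simp add: young_at_def)
  \<comment> \<open>Needed because \<open>card\<close> of an infinite set is 0, so the bounds on
    uses alone would not give finite sets.\<close>
  have "finite C" using finD cov finite_UnionD by blast
  define I where "I = fst ` steps D"
  have "\<forall>s\<in>I. \<exists>t. (s, t) \<in> steps D" by (auto simp: I_def)
  then obtain col where col: "\<And>s. s \<in> I \<Longrightarrow> (s, col s) \<in> steps D" by metis
  have colD: "(s, col s) \<in> D" if "s \<in> I" for s using col[OF that] by (simp add: steps_def)
  have "card I < (a + b) choose a"
  proof (rule skew_pairs_bound)
    show "finite I" using finite_steps[OF finD] by (simp add: I_def)
  next
    fix i assume "i \<in> I"
    then show "finite {R \<in> C. i \<in> fst ` R} \<and> card {R \<in> C. i \<in> fst ` R} \<le> a"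
      and "finite {R \<in> C. col i \<in> snd ` R} \<and> card {R \<in> C. col i \<in> snd ` R} \<le> b"
      using rows[of i] cols[of "col i"] colD[of i] \<open>finite C\<close> by force+
  next
    fix i j assume ij: "i \<in> I" "j \<in> I"
    have "{R \<in> C. i \<in> fst ` R} \<inter> {R \<in> C. col j \<in> snd ` R} \<noteq> {} \<longleftrightarrow> (\<exists>R\<in>C. (i, col j) \<in> R)"
    proof -
      have "(i, col j) \<in> R \<longleftrightarrow> i \<in> fst ` R \<and> col j \<in> snd ` R" if "R \<in> C" for R
        using rect[OF that] by (metis mem_Sigma_iff)
      then show ?thesis by blast
    qed
    also have "\<dots> \<longleftrightarrow> (i, col j) \<in> D" using cov by blast
    \<comment> \<open>If \<open>j < i\<close>, the cell below the step in row \<open>j\<close> would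
      lie in \<open>D\<close>; if \<open>i \<le> j\<close>, the cell is dominated by the step in row
      \<open>i\<close>.\<close>
    also have "\<dots> \<longleftrightarrow> i \<le> j"
    proof
      assume "(i, col j) \<in> D"
      show "i \<le> j"
      proof (rule ccontr)
        assume "\<not> i \<le> j"
        then have "(j + 1, col j) \<in> D"
          using young_at_bounds[OF D colD[OF ij(2)]]
          by - (rule young_at_mem[OF D \<open>(i, col j) \<in> D\<close>], auto)
        then show False using col[OF ij(2)] by (simp add: steps_def)
      qed
    next
      assume "i \<le> j"
      then have "col j \<le> col i"
        using steps_antimono[OF D col[OF ij(1)] col[OF ij(2)]] by (cases "i = j") auto
      then show "(i, col j) \<in> D"
        using young_at_bounds[OF D colD[OF ij(1)]] young_at_bounds[OF D colD[OF ij(2)]]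
        by - (rule young_at_mem[OF D colD[OF ij(1)]], auto)
    qed
    finally show "{R \<in> C. i \<in> fst ` R} \<inter> {R \<in> C. col j \<in> snd ` R} \<noteq> {} \<longleftrightarrow> i \<le> j" .
  qed
  then show ?thesis
    unfolding I_def by (simp add: card_image[OF inj_on_fst_steps[OF D]])
qed

text \<open>The symmetric case \<open>a = b = k\<close> at the corner \<open>(0, 0)\<close> of
  \<open>steps_bound_of_cover\<close> and \<open>exists_cover\<close>.\<close>

theorem theorem1:
  fixes k r c :: nat and Y :: "(nat \<times> nat) set"
  assumes "1 \<le> k"
    and "young_diagram r c Y"
  shows "(\<exists>C. (\<forall>R\<in>C. gen_rectangle r c Y R) \<and> covers C Y \<and>
            (\<forall>s\<in>{1..r}. card {R \<in> C. s \<in> rows_used R} \<le> k) \<and>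
            (\<forall>t\<in>{1..c}. card {R \<in> C. t \<in> cols_used R} \<le> k))
         \<longleftrightarrow> card (steps Y) < (2 * k) choose k"
    (is "(\<exists>C. ?good C) \<longleftrightarrow> _")
proof
  have Y: "young_at 0 0 Y" using assms(2) by (rule young_diagram_young_at)
  have sub: "Y \<subseteq> {1..r} \<times> {1..c}" using assms(2) by (simp add: young_diagram_def)
  {
    assume "\<exists>C. ?good C"
    then obtain C where rect: "\<And>R. R \<in> C \<Longrightarrow> gen_rectangle r c Y R" and cov: "covers C Y"
      and rows: "\<And>s. s \<in> {1..r} \<Longrightarrow> card {R \<in> C. s \<in> rows_used R} \<le> k"
      and cols: "\<And>t. t \<in> {1..c} \<Longrightarrow> card {R \<in> C. t \<in> cols_used R} \<le> k"
      by (elim exE conjE) (rule that; (erule (1) bspec | assumption))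
    have "card (steps Y) < (k + k) choose k"
    proof (rule steps_bound_of_cover[OF Y])
      show "fst ` R \<times> snd ` R = R" if "R \<in> C" for R
      proof -
        obtain S T where "R = S \<times> T" using rect[OF \<open>R \<in> C\<close>] unfolding gen_rectangle_def by blast
        then show ?thesis by auto
      qed
      show "\<Union>C = Y" using cov by (simp add: covers_def)
      show "card {R \<in> C. s \<in> fst ` R} \<le> k" if "s \<in> fst ` Y" for s
      proof -
        have "s \<in> {1..r}" using that sub by auto
        then show ?thesis using rows by (simp add: rows_used_def)
      qed
      show "card {R \<in> C. t \<in> snd ` R} \<le> k" if "t \<in> snd ` Y" for t
      proof -
        have "t \<in> {1..c}" using that sub by auto
        then show ?thesis using cols by (simp add: cols_used_def)
      qed
    qed
    then show "card (steps Y) < (2 * k) choose k" by (simp add: mult_2)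
  next
    assume "card (steps Y) < (2 * k) choose k"
    then have "card (steps Y) < (k + k) choose k" by (simp add: mult_2)
    from exists_cover[OF Y this] obtain C where C: "\<And>R. R \<in> C \<Longrightarrow> fst ` R \<times> snd ` R = R" "\<Union>C = Y"
      "\<And>s. card {R \<in> C. s \<in> fst ` R} \<le> k" "\<And>t. card {R \<in> C. t \<in> snd ` R} \<le> k"
      by (elim exE conjE) (rule that; (erule spec | erule (1) bspec | assumption))
    have "gen_rectangle r c Y R" if "R \<in> C" for R
      unfolding gen_rectangle_def
    proof (intro exI conjI)
      show "R \<subseteq> Y" using that C(2) by blast
      then have "R \<subseteq> {1..r} \<times> {1..c}" using sub by (rule subset_trans)
      then show "fst ` R \<subseteq> {1..r}" "snd ` R \<subseteq> {1..c}" by auto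
      show "R = fst ` R \<times> snd ` R" using C(1)[OF that] by simp
    qed
    moreover have "covers C Y" using C(2) by (simp add: covers_def)
    ultimately have "?good C" using C(3,4) by (simp add: rows_used_def cols_used_def)
    then show "\<exists>C. ?good C" ..
  }
qed

end
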